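(* Assume the ABC Conjecture over $\mathbb{Z}$. There is an absolute constant $c>0$ such that the following holds. Let $N>0$ be an integer and let $E_N$ be the elliptic curve $y^2=x^3-Nx$ over $\mathbb{Q}$. Let $Q_1\in E_N(\mathbb{Q})$ be a non-torsion point with $x(Q_1)<0$. (1) For every nonzero integer $n$ with $L(nQ_1)\le 1$, we have $h_O(nQ_1)\le c\log N$. (2) Let $Q_2\in E_N(\mathbb{Q})$ be such that $Q_1,Q_2$ are linearly independent (no relation $aQ_1+bQ_2=O$ with integers $(a,b)\ne(0,0)$). Assume moreover that either $Q_2=2R$ for some $R\in E_N(\mathbb{Q})$, or $x(Q_2)$ is the square of a rational number. Let $G=\langle Q_1,Q_2\rangle=\{n_1Q_1+n_2Q_2: n_1,n_2\in\mathbb{Z}\}$. Then for every $Q\in G$ with $Q\neq O$ and $L(Q)\le 1$ we have $h_O(Q)\le c\log N$.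
   Context: ABC Conjecture over $\mathbb{Z}$: for every $\epsilon>0$ there is a constant $K_\epsilon$ such that for all coprime integers $a,b,c$ with $a+b=c$ one has $\max(|a|,|b|,|c|)\le K_\epsilon\,\mathrm{rad}(abc)^{1+\epsilon}$, where $\mathrm{rad}(m)$ is the product of the distinct primes dividing $m$. The constant $c$ may depend on the constants $K_\epsilon$ of the ABC Conjecture, but not on $N$, the points, or the integers $n,n_1,n_2$. $O$ denotes the point at infinity. For a rational point $Q\ne O$, $h_O(Q)=\max\{0,\log|x(Q)|\}$. For a rational point $Q\ne O$ on an elliptic curve in Weierstrass form over $\mathbb{Q}$, the length $L(Q)$ is the number of distinct primes $p$ with $|x(Q)|_p>1$, where $|\cdot|_p$ is the usual $p$-adic absolute value. Equivalently, write $x(Q)=A_Q/B_Q^2$ in lowest terms; then $L(Q)$ is the number of distinct prime divisors of $B_Q$. *)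

theory Defs
  imports Complex_Main "HOL-Computational_Algebra.Primes"
begin

datatype ecpt = Inf | Pt rat rat

fun on_curve :: "int \<Rightarrow> ecpt \<Rightarrow> bool" where
  "on_curve N Inf = True"
| "on_curve N (Pt x y) = (y ^ 2 = x ^ 3 - of_int N * x)"

fun ec_add :: "int \<Rightarrow> ecpt \<Rightarrow> ecpt \<Rightarrow> ecpt" where
  "ec_add N Inf Q = Q"
| "ec_add N P Inf = P"
| "ec_add N (Pt x1 y1) (Pt x2 y2) =
     (if x1 = x2 \<and> y1 = - y2 then Inf
      else let l = (if x1 = x2 then (3 * x1 ^ 2 - of_int N) / (2 * y1)
                    else (y2 - y1) / (x2 - x1));
               x3 = l ^ 2 - x1 - x2;
               y3 = l * (x1 - x3) - y1
           in Pt x3 y3)"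

fun ec_neg :: "ecpt \<Rightarrow> ecpt" where
  "ec_neg Inf = Inf"
| "ec_neg (Pt x y) = Pt x (- y)"

fun ec_nmul :: "int \<Rightarrow> nat \<Rightarrow> ecpt \<Rightarrow> ecpt" where
  "ec_nmul N 0 P = Inf"
| "ec_nmul N (Suc n) P = ec_add N P (ec_nmul N n P)"

definition ec_mul :: "int \<Rightarrow> int \<Rightarrow> ecpt \<Rightarrow> ecpt" where
  "ec_mul N n P = (if 0 \<le> n then ec_nmul N (nat n) P else ec_neg (ec_nmul N (nat (- n)) P))"

fun xcoord :: "ecpt \<Rightarrow> rat" where
  "xcoord Inf = 0"
| "xcoord (Pt x y) = x"

definition hO :: "ecpt \<Rightarrow> real" where
  "hO Q = max 0 (ln \<bar>real_of_rat (xcoord Q)\<bar>)"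

text \<open>Length L(Q): number of distinct primes p with |x(Q)|_p > 1, i.e. the number of
  distinct prime divisors of the denominator of x(Q) in lowest terms.\<close>
definition ec_len :: "ecpt \<Rightarrow> nat" where
  "ec_len Q = card (prime_factors (snd (quotient_of (xcoord Q))))"

definition rad :: "int \<Rightarrow> int" where
  "rad m = (\<Prod>p\<in>prime_factors m. p)"

definition abc_conjecture :: bool where
  "abc_conjecture \<longleftrightarrow>
     (\<forall>\<epsilon>::real. \<epsilon> > 0 \<longrightarrow> (\<exists>K::real. \<forall>a b c :: int.
        coprime a b \<and> coprime b c \<and> coprime a c \<and> a + b = c \<longrightarrow>
        real_of_int (max \<bar>a\<bar> (max \<bar>b\<bar> \<bar>c\<bar>)) \<le> K * (real_of_int (rad (a * b * c))) powr (1 + \<epsilon>)))"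

end

theory Submission
  imports Defs "HOL-Computational_Algebra.Nth_Powers"
begin

text \<open>
  The descent map sends \<open>O\<close> to \<open>1\<close>, \<open>(0,0)\<close> to \<open>-N\<close> and any other \<open>(x,y)\<close> to \<open>x\<close>. It is
  multiplicative modulo squares, because the three intersection points of the curve with a line
  \<open>y = l x + n\<close> satisfy \<open>x\<^sub>1 x\<^sub>2 x\<^sub>3 = n\<^sup>2\<close>. The image of \<open>Q\<^sub>2\<close> is a square, so that of
  \<open>n\<^sub>1 Q\<^sub>1 + n\<^sub>2 Q\<^sub>2\<close> is negative for odd \<open>n\<^sub>1\<close>, whence \<open>-\<surd>N \<le> x(Q) \<le> 0\<close>, and a
  square for even \<open>n\<^sub>1\<close>.

  In the latter case \<open>x(Q) = a\<^sup>2 / B\<^sup>2\<close> with \<open>a\<^sup>4 - N B\<^sup>4 = c\<^sup>2\<close>, that is, \<open>u v = N B\<^sup>4\<close> and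
  \<open>u + v = 2 a\<^sup>2\<close> for \<open>u = a\<^sup>2 - c\<close>, \<open>v = a\<^sup>2 + c\<close>, where \<open>c \<ge> 0\<close>. Since \<open>B\<close> is a prime power, \<open>B\<^sup>4\<close>
  divides \<open>2 u\<close> or \<open>2 v\<close>, so one of \<open>u\<close>, \<open>v\<close> is at most \<open>2 N\<close>. If it is \<open>v\<close>, then \<open>a\<^sup>2 \<le> 2 N\<close>; if
  it is \<open>u\<close>, the ABC bound for \<open>u\<^sup>2 + N B\<^sup>4 = 2 u a\<^sup>2\<close>, in which \<open>a\<close> has size about \<open>B\<^sup>2\<close>, reads
  \<open>B\<^sup>4 \<le> N\<^bsup>O(1)\<^esup> B\<^bsup>3(1+\<epsilon>)\<^esup>\<close> and bounds \<open>B\<close> once \<open>\<epsilon> < 1/3\<close>; we take \<open>\<epsilon> = 1/6\<close>. Multiplicative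
  constants are absorbed into powers of \<open>N \<ge> 2\<close>; for \<open>N = 1\<close> a point with \<open>x = n / d\<close> makes
  \<open>n d (n\<^sup>2 - d\<^sup>2)\<close> a square, but this is the area of the right triangle with sides \<open>n\<^sup>2 - d\<^sup>2\<close>,
  \<open>2 n d\<close>, \<open>n\<^sup>2 + d\<^sup>2\<close> and vanishes by Fermat's descent, so that the point is 2-torsion.
\<close>

section \<open>Fermat's right triangle theorem\<close>

lemma coprime_mult_eq_power_natE:
  fixes a b c :: nat
  assumes "coprime a b" "a * b = c ^ n" "n > 0"
  obtains r s where "a = r ^ n" "b = s ^ n" "c = r * s"
proof -
  have "is_nth_power n (a * b)" using assms(2) by (auto simp: is_nth_power_def)
  then have "is_nth_power n a" "is_nth_power n b"
    using is_nth_power_mult_coprime_natD[OF assms(1), of n]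
    by (cases "a = 0 \<or> b = 0"; use assms in auto)+
  then obtain r s where powers: "a = r ^ n" "b = s ^ n" by (auto simp: is_nth_power_def)
  then have "(r * s) ^ n = c ^ n" using assms(2) by (simp add: power_mult_distrib)
  then have "c = r * s" using assms(3) by (simp add: power_eq_iff_eq_base)
  with powers show thesis by (rule that)
qed

lemma primitive_pythagorean_tripleE:
  fixes x y z :: nat
  assumes "coprime x y" "even x" "x ^ 2 + y ^ 2 = z ^ 2"
  obtains r s where "x = 2 * (r * s)" "s ^ 2 + y = r ^ 2" "z = r ^ 2 + s ^ 2" "coprime r s"
proof -
  have "odd y" using coprime_common_divisor[OF assms(1,2)] by auto
  then have "odd z" using assms(2,3) by (metis even_add even_power pos2)
  have "y \<le> z" using assms(3) by (metis le_add2 power2_nat_le_eq_le)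
  moreover have "even (z - y)" using \<open>odd y\<close> \<open>odd z\<close> by simp
  ultimately obtain t where z: "z = y + 2 * t" by (metis dvdE le_add_diff_inverse)
  obtain w where x: "x = 2 * w" using assms(2) by blast
  have product: "t * (t + y) = w ^ 2"
    using assms(3) unfolding z x by (simp add: power2_eq_square algebra_simps)
  have "coprime (w ^ 2) y" using assms(1) by (simp add: x)
  moreover have "t dvd w ^ 2" by (simp flip: product)
  ultimately have "coprime t y" by (metis coprime_divisors dvd_refl)
  then have "coprime t (t + y)" by (simp add: coprime_iff_gcd_eq_1)
  then obtain s r where squares: "t = s ^ 2" "t + y = r ^ 2" "w = s * r"
    using product by (rule coprime_mult_eq_power_natE) simp
  have "coprime r s" using \<open>coprime t (t + y)\<close> squares by (simp add: coprime_commute)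
  then show thesis using that[of r s] squares z x by (simp add: mult.commute)
qed

lemma primitive_right_triangle_square_areaE:
  fixes x y z w :: nat
  assumes "coprime x y" "even x" "x ^ 2 + y ^ 2 = z ^ 2" "x * y = 2 * w ^ 2" "w > 0"
  obtains a b c d where "a ^ 2 = b ^ 2 + c ^ 2" "d ^ 2 = a ^ 2 + b ^ 2" "odd c" "odd d"
    "a > 0" "b > 0" "z = a ^ 4 + b ^ 4"
proof -
  have pos: "x > 0" "y > 0" using assms(4,5) by (auto intro: Nat.gr0I)
  have "odd y" using coprime_common_divisor[OF assms(1,2)] by auto
  obtain r s where rs: "x = 2 * (r * s)" "s ^ 2 + y = r ^ 2" "z = r ^ 2 + s ^ 2" "coprime r s"
    using assms(1-3) by (rule primitive_pythagorean_tripleE)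
  have "s ^ 2 < r ^ 2" using rs(2) pos by simp
  then have "s < r" by (rule power_less_imp_less_base) simp
  then obtain u where u: "r = s + u" using less_imp_add_positive by blast
  have y: "y = u * (r + s)" using rs(2) unfolding u by (simp add: power2_eq_square algebra_simps)
  have "coprime (r * s) y" using assms(1) by (simp add: rs(1))
  moreover have "r * s * y = w ^ 2" using assms(4) by (simp add: rs(1))
  ultimately obtain f g where "r * s = f ^ 2" and g: "y = g ^ 2"
    by (rule coprime_mult_eq_power_natE) simp
  with rs(4) obtain a b where ab: "r = a ^ 2" "s = b ^ 2" by (metis coprime_mult_eq_power_natE pos2)
  have "2 * s dvd x" "u dvd y" by (simp_all add: rs(1) y)
  then have "coprime (2 * s) u" using assms(1) by (metis coprime_divisors)
  then have "coprime u (u + 2 * s)" by (simp add: coprime_iff_gcd_eq_1 gcd.commute)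
  moreover have "u + 2 * s = r + s" by (simp add: u)
  ultimately have "coprime u (r + s)" by simp
  then obtain c d where cd: "u = c ^ 2" "r + s = d ^ 2"
    using y g by (metis coprime_mult_eq_power_natE pos2)
  have "odd c" "odd d" using \<open>odd y\<close> y cd by simp_all
  moreover have "a > 0" "b > 0" using pos(1) rs(1) ab by auto
  moreover have "z = a ^ 4 + b ^ 4" by (simp add: rs(3) ab)
  ultimately show thesis using that[of a b c d] u ab cd by simp
qed

lemma right_triangle_of_squares_in_progressionE:
  fixes a b c d :: nat
  assumes "a ^ 2 = b ^ 2 + c ^ 2" "d ^ 2 = a ^ 2 + b ^ 2" "odd c" "odd d"
  obtains x y w where "x ^ 2 + y ^ 2 = a ^ 2" "x * y = 2 * w ^ 2" "b = 2 * w"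
proof -
  have "c ^ 2 \<le> d ^ 2" using assms(1,2) by simp
  then have "c \<le> d" by simp
  moreover have "even (d - c)" using assms(3,4) by simp
  ultimately obtain e where e: "d = c + 2 * e" by (metis dvdE le_add_diff_inverse)
  have "d ^ 2 = c ^ 2 + 2 * b ^ 2" using assms(1,2) by simp
  then have b_sq: "b ^ 2 = 2 * (e * (c + e))"
    unfolding e by (simp add: power2_eq_square algebra_simps)
  then have "even b" by (metis dvd_triv_left even_power)
  then obtain w where w: "b = 2 * w" by blast
  have "a ^ 2 = 2 * (e * (c + e)) + c ^ 2" by (simp only: assms(1) b_sq)
  then have "e ^ 2 + (c + e) ^ 2 = a ^ 2" by (simp add: power2_eq_square algebra_simps)
  moreover have "e * (c + e) = 2 * w ^ 2" using b_sq w by (simp add: power2_eq_square)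
  ultimately show thesis using w by (rule that)
qed

lemma primitive_right_triangle_descentE:
  fixes x y z w :: nat
  assumes "coprime x y" "x ^ 2 + y ^ 2 = z ^ 2" "x * y = 2 * w ^ 2" "w > 0"
  obtains x' y' z' w' where
    "x' ^ 2 + y' ^ 2 = z' ^ 2" "x' * y' = 2 * w' ^ 2" "w' > 0" "z' < z"
proof -
  have "even x \<or> even y" using assms(3) by (metis dvd_triv_left even_mult_iff)
  moreover have "coprime y x" "y ^ 2 + x ^ 2 = z ^ 2" "y * x = 2 * w ^ 2"
    using assms by (simp_all add: coprime_commute add.commute mult.commute)
  ultimately obtain a b c d where squares: "a ^ 2 = b ^ 2 + c ^ 2" "d ^ 2 = a ^ 2 + b ^ 2"
    "odd c" "odd d" and pos: "a > 0" "b > 0" and z: "z = a ^ 4 + b ^ 4"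
    using assms by (metis primitive_right_triangle_square_areaE)
  obtain x' y' w' where smaller: "x' ^ 2 + y' ^ 2 = a ^ 2" "x' * y' = 2 * w' ^ 2" "b = 2 * w'"
    using squares by (rule right_triangle_of_squares_in_progressionE)
  have "a \<le> a ^ 4" by (rule self_le_power) (use pos in auto)
  then have "a < z" using pos(2) z by (simp add: add.commute add_pos_pos le_less_trans)
  then show thesis using that smaller pos(2) by simp
qed

lemma right_triangle_common_prime_factorE:
  fixes x y z w p :: nat
  assumes "prime p" "(p * x) ^ 2 + (p * y) ^ 2 = z ^ 2" "(p * x) * (p * y) = 2 * w ^ 2"
  obtains z' w' where "z = p * z'" "w = p * w'" "x ^ 2 + y ^ 2 = z' ^ 2" "x * y = 2 * w' ^ 2"
proof -
  have "p ^ 2 dvd z ^ 2" by (simp add: power_mult_distrib flip: assms(2) distrib_left)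
  then have "p dvd z" by simp
  then obtain z' where z: "z = p * z'" by blast
  have w_sq: "2 * w ^ 2 = p * (p * (x * y))" using assms(3) by (simp add: mult_ac)
  have "p dvd w"
  proof (cases "p = 2")
    case True
    then have "w ^ 2 = 2 * (x * y)" using w_sq by simp
    then show ?thesis using True by (metis dvd_triv_left even_power)
  next
    case False
    then have "\<not> p dvd 2" using assms(1) by (metis primes_dvd_imp_eq two_is_prime_nat)
    then show ?thesis using assms(1) w_sq
      by (metis dvd_triv_left prime_dvd_mult_iff prime_dvd_power)
  qed
  then obtain w' where w: "w = p * w'" by blast
  have "p ^ 2 * (x ^ 2 + y ^ 2) = p ^ 2 * z' ^ 2" "p ^ 2 * (x * y) = p ^ 2 * (2 * w' ^ 2)"
    using assms(2,3) unfolding z w by (simp_all add: power2_eq_square algebra_simps)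
  then have "x ^ 2 + y ^ 2 = z' ^ 2" "x * y = 2 * w' ^ 2" using assms(1) by auto
  with z w show thesis by (rule that)
qed

lemma fermat_right_triangle_nat:
  fixes x y z w :: nat
  assumes "x ^ 2 + y ^ 2 = z ^ 2" "x * y = 2 * w ^ 2"
  shows "w = 0"
  using assms
proof (induction z arbitrary: x y w rule: less_induct)
  case (less z)
  show ?case
  proof (rule ccontr)
    assume "w \<noteq> 0"
    then have "w > 0" by simp
    show False
    proof (cases "coprime x y")
      case True
      then show False
        using primitive_right_triangle_descentE[OF _ less.prems \<open>w > 0\<close>] less.IH
        by (metis less_irrefl)
    next
      case False
      then obtain p where p: "prime p" "p dvd x" "p dvd y"
        by (metis coprime_iff_gcd_eq_1 gcd_dvd1 gcd_dvd2 dvd_trans prime_factor_nat)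
      then obtain x' y' where "x = p * x'" "y = p * y'" by (auto elim!: dvdE)
      with p(1) less.prems obtain z' w' where zw: "z = p * z'" "w = p * w'"
        and smaller: "x' ^ 2 + y' ^ 2 = z' ^ 2" "x' * y' = 2 * w' ^ 2"
        by (metis right_triangle_common_prime_factorE)
      have "z > 0" using less.prems \<open>w > 0\<close> by (auto intro!: Nat.gr0I)
      then have "z' < z" using zw(1) prime_gt_1_nat[OF p(1)] by simp
      then have "w' = 0" using less.IH smaller by blast
      then show False using zw(2) \<open>w > 0\<close> by simp
    qed
  qed
qed

theorem fermat_right_triangle:
  fixes x y z w :: int
  assumes "x ^ 2 + y ^ 2 = z ^ 2" "x * y = 2 * w ^ 2"
  shows "w = 0"
proof -
  have "int (nat \<bar>x\<bar> ^ 2 + nat \<bar>y\<bar> ^ 2) = int (nat \<bar>z\<bar> ^ 2)" using assms(1) by simp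
  then have "nat \<bar>x\<bar> ^ 2 + nat \<bar>y\<bar> ^ 2 = nat \<bar>z\<bar> ^ 2" by (simp only: of_nat_eq_iff)
  moreover have "int (nat \<bar>x\<bar> * nat \<bar>y\<bar>) = int (2 * nat \<bar>w\<bar> ^ 2)"
    using assms(2) by (simp flip: abs_mult)
  then have "nat \<bar>x\<bar> * nat \<bar>y\<bar> = 2 * nat \<bar>w\<bar> ^ 2" by (simp only: of_nat_eq_iff)
  ultimately have "nat \<bar>w\<bar> = 0" by (rule fermat_right_triangle_nat)
  then show ?thesis by simp
qed

lemma rat_power_eq_of_intE:
  fixes q :: rat
  assumes "q ^ n = of_int m" "n > 0"
  obtains k where "q = of_int k" "m = k ^ n"
proof -
  obtain a d where "q = Fract a d" "d > 0" "coprime a d" by (rule Rat_cases)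
  then have q: "q = of_int a / of_int d" by (simp add: Fract_of_int_quotient)
  have "of_int (a ^ n) = (of_int (m * d ^ n) :: rat)"
    using assms(1) \<open>d > 0\<close> unfolding q by (simp add: power_divide field_simps)
  then have a: "a ^ n = m * d ^ n" by (simp only: of_int_eq_iff)
  then have "d dvd a" using assms(2) by (metis dvd_triv_right pow_divides_pow_iff)
  then have "is_unit d" by (rule coprime_common_divisor[OF \<open>coprime a d\<close> _ dvd_refl])
  then have "d = 1" using \<open>d > 0\<close> by simp
  then show thesis using that[of a] q a by simp
qed

lemma rat_square_eq_cube_minus_self_imp_eq_0:
  fixes x y :: rat
  assumes "y ^ 2 = x ^ 3 - x"
  shows "y = 0"
proof -
  obtain n d where "x = Fract n d" "d > 0" by (rule Rat_cases)
  then have x: "x = of_int n / of_int d" by (simp add: Fract_of_int_quotient)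
  have "(y * of_int d ^ 2) ^ 2 = (x ^ 3 - x) * of_int d ^ 4"
    using assms by (simp add: power_mult_distrib)
  also have "\<dots> = of_int (n * d * (n ^ 2 - d ^ 2))"
    using \<open>d > 0\<close> unfolding x by (simp add: field_simps eval_nat_numeral)
  finally obtain k where k: "y * of_int d ^ 2 = of_int k" "n * d * (n ^ 2 - d ^ 2) = k ^ 2"
    by (rule rat_power_eq_of_intE) simp
  have "(n ^ 2 - d ^ 2) ^ 2 + (2 * n * d) ^ 2 = (n ^ 2 + d ^ 2) ^ 2" by algebra
  moreover have "(n ^ 2 - d ^ 2) * (2 * n * d) = 2 * k ^ 2" by (simp flip: k(2))
  ultimately have "k = 0" by (rule fermat_right_triangle)
  then show ?thesis using k(1) \<open>d > 0\<close> by simp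
qed

section \<open>The group law\<close>

lemma ec_add_Inf_right [simp]: "ec_add N P Inf = P"
  by (cases P) simp_all

lemma on_curve_ec_neg [simp]: "on_curve N (ec_neg P) = on_curve N P"
  by (cases P) auto

lemma ec_add_ec_neg [simp]: "ec_add N (ec_neg P) P = Inf"
  by (cases P) auto

lemma ec_add_chord_tangentE:
  assumes "on_curve N (Pt x1 y1)" "on_curve N (Pt x2 y2)" "Pt x1 y1 \<noteq> ec_neg (Pt x2 y2)"
  obtains l n x3 where
    "ec_add N (Pt x1 y1) (Pt x2 y2) = Pt x3 (- (l * x3 + n))"
    "x1 + x2 + x3 = l ^ 2"
    "x1 * x2 + x1 * x3 + x2 * x3 = - of_int N - 2 * l * n"
    "x1 * x2 * x3 = n ^ 2"
proof -
  define l where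
    "l = (if x1 = x2 then (3 * x1 ^ 2 - of_int N) / (2 * y1) else (y2 - y1) / (x2 - x1))"
  define n where "n = y1 - l * x1"
  define x3 where "x3 = l ^ 2 - x1 - x2"
  define M :: rat where "M = of_int N"
  have curve: "y1 ^ 2 = x1 ^ 3 - M * x1" "y2 ^ 2 = x2 ^ 3 - M * x2"
    using assms by (auto simp: M_def)
  have sum: "ec_add N (Pt x1 y1) (Pt x2 y2) = Pt x3 (- (l * x3 + n))"
    using assms(3) by (simp add: l_def[symmetric] x3_def n_def Let_def algebra_simps)
  have y1: "y1 = l * x1 + n" by (simp add: n_def)
  have linear: "x1 + x2 + x3 = l ^ 2" by (simp add: x3_def)
  have quadratic: "x1 * x2 + x1 * x3 + x2 * x3 = - M - 2 * l * n"
  proof (cases "x1 = x2")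
    case True
    then have "y1 ^ 2 = y2 ^ 2" using curve by simp
    then have "y1 \<noteq> 0" using assms(3) True by (auto simp: power2_eq_iff)
    then have "2 * y1 * l = 3 * x1 ^ 2 - M" using True by (simp add: l_def M_def)
    then show ?thesis using True unfolding x3_def n_def
      by (simp add: power2_eq_square algebra_simps)
  next
    case False
    then have "l * (x2 - x1) = y2 - y1" by (simp add: l_def)
    then have y2: "y2 = l * x2 + n" by (simp add: n_def algebra_simps)
    have "(x1 - x2) * (x1 * x2 + x1 * x3 + x2 * x3) = (x1 - x2) * (- M - 2 * l * n)"
      using curve unfolding y1 y2 x3_def by algebra
    then show ?thesis using False by simp
  qed
  have "x1 * x2 * x3 = n ^ 2" using curve(1) linear quadratic unfolding y1 by algebra
  then show thesis using that[OF sum linear] quadratic by (simp add: M_def)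
qed

lemma ec_add_cases [case_names Inf_left Inf_right inverse line]:
  assumes "on_curve N P" "on_curve N Q"
  obtains "P = Inf" | "Q = Inf" | "P = ec_neg Q"
  | x1 y1 x2 y2 x3 l n where "P = Pt x1 y1" "Q = Pt x2 y2" "ec_add N P Q = Pt x3 (- (l * x3 + n))"
    "x1 + x2 + x3 = l ^ 2"
    "x1 * x2 + x1 * x3 + x2 * x3 = - of_int N - 2 * l * n"
    "x1 * x2 * x3 = n ^ 2"
proof (cases "P = Inf \<or> Q = Inf \<or> P = ec_neg Q")
  case True
  with that(1-3) show thesis by blast
next
  case False
  then obtain x1 y1 x2 y2 where "P = Pt x1 y1" "Q = Pt x2 y2" by (cases P; cases Q) auto
  with False assms ec_add_chord_tangentE[of N x1 y1 x2 y2] that(4) show thesis by metis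
qed

lemma on_curve_ec_add:
  assumes "on_curve N P" "on_curve N Q"
  shows "on_curve N (ec_add N P Q)"
  using assms
proof (cases rule: ec_add_cases)
  case (line x1 y1 x2 y2 x3 l n)
  have "(l * x3 + n) ^ 2 = x3 ^ 3 - of_int N * x3" using line(4-6) by algebra
  then show ?thesis by (simp only: line(3) on_curve.simps power2_minus)
qed (use assms in simp_all)

lemma on_curve_ec_nmul: "on_curve N P \<Longrightarrow> on_curve N (ec_nmul N k P)"
  by (induction k) (simp_all add: on_curve_ec_add)

lemma on_curve_ec_mul: "on_curve N P \<Longrightarrow> on_curve N (ec_mul N m P)"
  by (simp add: ec_mul_def on_curve_ec_nmul)

lemma ec_mul_0 [simp]: "ec_mul N 0 P = Inf"
  by (simp add: ec_mul_def)

lemma ec_mul_2_Pt_0 [simp]: "ec_mul N 2 (Pt x 0) = Inf"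
  by (simp add: ec_mul_def numeral_2_eq_2)

lemma ec_mul_2_curve_one:
  assumes "on_curve 1 P"
  shows "ec_mul 1 2 P = Inf"
proof (cases P)
  case Inf
  then show ?thesis by (simp add: ec_mul_def numeral_2_eq_2)
next
  case (Pt x y)
  then have "y = 0" using assms by (intro rat_square_eq_cube_minus_self_imp_eq_0) simp
  with Pt show ?thesis by simp
qed

lemma ge_2_if_not_2_torsion:
  assumes "on_curve N P" "ec_mul N 2 P \<noteq> Inf" "N > 0"
  shows "N \<ge> 2"
  using assms ec_mul_2_curve_one[of P] by (cases "N = 1") auto

section \<open>The descent map\<close>

definition same_square_class :: "'a::field \<Rightarrow> 'a \<Rightarrow> bool" where
  "same_square_class a b \<longleftrightarrow> (\<exists>t. t \<noteq> 0 \<and> a = b * t ^ 2)"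

lemma same_square_classI:
  assumes "a * b = t ^ 2" "t \<noteq> 0"
  shows "same_square_class a b"
  unfolding same_square_class_def
proof (intro exI conjI)
  have "b \<noteq> 0" using assms by auto
  then show "t / b \<noteq> 0" "a = b * (t / b) ^ 2"
    using assms by (simp_all add: field_simps power2_eq_square)
qed

lemma same_square_class_refl [simp]: "same_square_class a a"
  unfolding same_square_class_def by (rule exI[of _ 1]) simp

lemma same_square_class_mult:
  assumes "same_square_class a b" "same_square_class c d"
  shows "same_square_class (a * c) (b * d)"
proof -
  obtain s t where "s \<noteq> 0" "a = b * s ^ 2" "t \<noteq> 0" "c = d * t ^ 2"
    using assms by (auto simp: same_square_class_def)
  then show ?thesis unfolding same_square_class_def
    by (intro exI[of _ "s * t"]) (simp add: power_mult_distrib)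
qed

lemma same_square_class_trans [trans]:
  assumes "same_square_class a b" "same_square_class b c"
  shows "same_square_class a c"
proof -
  obtain s t where "s \<noteq> 0" "a = b * s ^ 2" "t \<noteq> 0" "b = c * t ^ 2"
    using assms by (auto simp: same_square_class_def)
  then show ?thesis unfolding same_square_class_def
    by (intro exI[of _ "s * t"]) (simp add: power_mult_distrib)
qed

lemma same_square_class_power:
  "same_square_class a b \<Longrightarrow> same_square_class (a ^ k) (b ^ k)"
  by (induction k) (simp_all add: same_square_class_mult)

lemma same_square_class_even_power:
  assumes "even k" "a \<noteq> 0"
  shows "same_square_class (a ^ k) 1"
proof -
  obtain j where "k = 2 * j" using assms(1) by blast
  then have "a ^ k * 1 = (a ^ j) ^ 2" by (simp add: power_mult power2_eq_square power_mult_distrib)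
  then show ?thesis by (rule same_square_classI) (simp add: assms(2))
qed

lemma same_square_class_neg_iff:
  fixes a b :: "'a::linordered_field"
  shows "same_square_class a b \<Longrightarrow> a < 0 \<longleftrightarrow> b < 0"
  by (auto simp: same_square_class_def mult_less_0_iff)

fun descent_image :: "int \<Rightarrow> ecpt \<Rightarrow> rat" where
  "descent_image N Inf = 1"
| "descent_image N (Pt x y) = (if x = 0 then - of_int N else x)"

lemma descent_image_nonzero: "N \<noteq> 0 \<Longrightarrow> descent_image N P \<noteq> 0"
  by (cases P) auto

lemma descent_image_ec_neg [simp]: "descent_image N (ec_neg P) = descent_image N P"
  by (cases P) auto

lemma descent_image_ec_add:
  assumes "N \<noteq> 0" "on_curve N P" "on_curve N Q"
  shows "same_square_class (descent_image N (ec_add N P Q)) (descent_image N P * descent_image N Q)"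
  using assms(2,3)
proof (cases rule: ec_add_cases)
  case inverse
  then show ?thesis using descent_image_nonzero[OF assms(1), of Q]
    by (intro same_square_classI[of _ _ "descent_image N Q"]) (simp_all add: power2_eq_square)
next
  case (line x1 y1 x2 y2 x3 l n)
  have images: "descent_image N P = (if x1 = 0 then - of_int N else x1)"
    "descent_image N Q = (if x2 = 0 then - of_int N else x2)"
    "descent_image N (ec_add N P Q) = (if x3 = 0 then - of_int N else x3)"
    unfolding line(3) by (simp_all add: line(1,2))
  show ?thesis
  proof (cases "n = 0")
    case True
    with line(5,6) consider "x1 = 0" "of_int N = - (x2 * x3)" | "x2 = 0" "of_int N = - (x1 * x3)"
      | "x3 = 0" "of_int N = - (x1 * x2)"
      by auto
    moreover have "(of_int N :: rat) \<noteq> 0" using assms(1) by simp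
    ultimately have
      "descent_image N (ec_add N P Q) * (descent_image N P * descent_image N Q) = of_int N ^ 2"
      unfolding images by cases (auto simp: power2_eq_square)
    then show ?thesis using assms(1) by (intro same_square_classI[of _ _ "of_int N"]) simp_all
  next
    case False
    then have "x1 \<noteq> 0" "x2 \<noteq> 0" "x3 \<noteq> 0" using line(6) by auto
    then have "descent_image N (ec_add N P Q) * (descent_image N P * descent_image N Q) = n ^ 2"
      using line(6) by (simp add: images mult_ac)
    then show ?thesis using False by (rule same_square_classI)
  qed
qed simp_all

lemma descent_image_double:
  assumes "N \<noteq> 0" "on_curve N P"
  shows "same_square_class (descent_image N (ec_add N P P)) 1"
proof -
  have "same_square_class (descent_image N (ec_add N P P)) (descent_image N P ^ 2)"
    using descent_image_ec_add[OF assms(1,2,2)] by (simp add: power2_eq_square)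
  also have "same_square_class \<dots> 1"
    using descent_image_nonzero[OF assms(1)] by (intro same_square_class_even_power) simp_all
  finally show ?thesis .
qed

lemma descent_image_square_xcoord:
  assumes "on_curve N P" "P \<noteq> Inf" "xcoord P = r ^ 2" "ec_mul N 2 P \<noteq> Inf"
  shows "same_square_class (descent_image N P) 1"
proof -
  obtain y where P: "P = Pt (r ^ 2) y" using assms(2,3) by (cases P) auto
  have "r \<noteq> 0"
  proof
    assume "r = 0"
    then have "P = Pt 0 0" using assms(1) P by simp
    then show False using assms(4) by simp
  qed
  then show ?thesis by (auto simp: P same_square_class_def)
qed

lemma descent_image_ec_nmul:
  assumes "N \<noteq> 0" "on_curve N P"
  shows "same_square_class (descent_image N (ec_nmul N k P)) (descent_image N P ^ k)"
proof (induction k)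
  case (Suc k)
  have "same_square_class (descent_image N (ec_nmul N (Suc k) P))
    (descent_image N P * descent_image N (ec_nmul N k P))"
    using assms by (simp add: descent_image_ec_add on_curve_ec_nmul)
  also have "same_square_class \<dots> (descent_image N P * descent_image N P ^ k)"
    using Suc by (intro same_square_class_mult) simp_all
  finally show ?case by simp
qed simp

lemma descent_image_ec_mul:
  assumes "N \<noteq> 0" "on_curve N P"
  shows "same_square_class (descent_image N (ec_mul N m P)) (descent_image N P ^ nat \<bar>m\<bar>)"
  using descent_image_ec_nmul[OF assms, of "nat \<bar>m\<bar>"] by (auto simp: ec_mul_def)

lemma descent_image_combination:
  assumes "N \<noteq> 0" "on_curve N P" "on_curve N Q" "same_square_class (descent_image N Q) 1"
  shows "same_square_class (descent_image N (ec_add N (ec_mul N m P) (ec_mul N n Q)))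
    (descent_image N P ^ nat \<bar>m\<bar>)"
proof -
  have "same_square_class (descent_image N (ec_mul N n Q)) (descent_image N Q ^ nat \<bar>n\<bar>)"
    by (rule descent_image_ec_mul[OF assms(1,3)])
  also have "same_square_class \<dots> 1"
    using same_square_class_power[OF assms(4)] by simp
  finally have "same_square_class (descent_image N (ec_mul N n Q)) 1" .
  then have "same_square_class (descent_image N (ec_mul N m P) * descent_image N (ec_mul N n Q))
    (descent_image N P ^ nat \<bar>m\<bar> * 1)"
    by (intro same_square_class_mult descent_image_ec_mul[OF assms(1,2)])
  with descent_image_ec_add show ?thesis
    using assms(1-3) by (metis mult_1_right on_curve_ec_mul same_square_class_trans)
qed

section \<open>The ABC bound without coprimality\<close>

lemma rad_pos: "rad m > 0"
  unfolding rad_def by (intro prod_pos) (simp add: in_prime_factors_imp_prime prime_gt_0_int)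

lemma rad_dvd: "rad m dvd m"
proof (cases "m = 0")
  case False
  have "rad m = prod_mset (mset_set (prime_factors m))"
    by (simp add: rad_def prod_unfold_prod_mset)
  also have "\<dots> dvd prod_mset (prime_factorization m)"
    by (intro prod_mset_subset_imp_dvd mset_set_set_mset_msubset)
  also have "\<dots> = normalize m" using False by (rule prod_mset_prime_factorization)
  finally show ?thesis by simp
qed simp

lemma rad_mono:
  assumes "n \<noteq> 0" "\<And>p. prime p \<Longrightarrow> p dvd m \<Longrightarrow> p dvd n"
  shows "rad m \<le> rad n"
proof -
  have "prime_factors m \<subseteq> prime_factors n"
    using assms by (auto simp: prime_factors_dvd)
  then have "rad m dvd rad n" unfolding rad_def by (intro prod_dvd_prod_subset) auto
  then show ?thesis using rad_pos by (rule zdvd_imp_le)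
qed

definition abc_bound :: "real \<Rightarrow> real \<Rightarrow> bool" where
  "abc_bound K e \<longleftrightarrow> (\<forall>a b c :: int.
     coprime a b \<and> coprime b c \<and> coprime a c \<and> a + b = c \<longrightarrow>
     real_of_int (max \<bar>a\<bar> (max \<bar>b\<bar> \<bar>c\<bar>)) \<le> K * real_of_int (rad (a * b * c)) powr (1 + e))"

lemma abc_bound_mono:
  assumes "abc_bound K e" "K \<le> K'"
  shows "abc_bound K' e"
proof -
  have "K * t powr (1 + e) \<le> K' * t powr (1 + e)" for t
    using assms(2) by (intro mult_right_mono) simp_all
  then show ?thesis using assms(1) unfolding abc_bound_def by (blast intro: order_trans)
qed

lemma abc_conjecture_abc_boundE:
  assumes "abc_conjecture" "e > 0"
  obtains k where "k \<ge> 0" "abc_bound (2 powr k) e"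
proof -
  obtain K where "abc_bound K e"
    using assms unfolding abc_conjecture_def abc_bound_def by blast
  then have "abc_bound (2 powr log 2 (max 1 K)) e" by (rule abc_bound_mono) simp
  moreover have "log 2 (max 1 K) \<ge> 0" by simp
  ultimately show thesis using that by blast
qed

lemma abc_bound_gcd:
  fixes a b :: int
  assumes "abc_bound K e" "K \<ge> 0" "e \<ge> 0" "a * b * (a + b) \<noteq> 0"
  shows "real_of_int \<bar>b\<bar>
    \<le> real_of_int (gcd a b) * (K * real_of_int (rad (a * b * (a + b))) powr (1 + e))"
proof -
  define g where "g = gcd a b"
  have "g > 0" using assms(4) by (auto simp: g_def)
  obtain a' b' where reduced: "a = a' * g" "b = b' * g" "coprime a' b'"
    using gcd_coprime_exists[of a b] \<open>g > 0\<close> unfolding g_def by auto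
  have coprimes: "coprime b' (a' + b')" "coprime a' (a' + b')"
    using reduced(3) by (simp_all add: coprime_iff_gcd_eq_1 gcd.commute[of b'])
  have "a * b * (a + b) = a' * b' * (a' + b') * g ^ 3"
    by (simp add: reduced(1,2) power3_eq_cube algebra_simps)
  then have "rad (a' * b' * (a' + b')) \<le> rad (a * b * (a + b))"
    using assms(4) by (intro rad_mono) auto
  have "real_of_int \<bar>b'\<bar> \<le> real_of_int (max \<bar>a'\<bar> (max \<bar>b'\<bar> \<bar>a' + b'\<bar>))" by simp
  also have "\<dots> \<le> K * real_of_int (rad (a' * b' * (a' + b'))) powr (1 + e)"
    using assms(1) reduced(3) coprimes unfolding abc_bound_def by blast
  also have "\<dots> \<le> K * real_of_int (rad (a * b * (a + b))) powr (1 + e)"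
    using \<open>rad (a' * b' * (a' + b')) \<le> rad (a * b * (a + b))\<close> assms(2,3) less_imp_le[OF rad_pos]
    by (intro mult_left_mono powr_mono2) auto
  finally have "real_of_int g * real_of_int \<bar>b'\<bar> \<le> real_of_int g * \<dots>"
    using \<open>g > 0\<close> by (intro mult_left_mono) auto
  moreover have "real_of_int \<bar>b\<bar> = real_of_int g * real_of_int \<bar>b'\<bar>"
    using \<open>g > 0\<close> by (simp add: reduced(2) abs_mult)
  ultimately show ?thesis by (simp only: g_def)
qed

section \<open>The quartic equation\<close>

lemma prime_power_if_card_prime_factors_le_1:
  fixes B :: int
  assumes "B > 0" "card (prime_factors B) \<le> 1"
  obtains p k where "prime p" "B = p ^ k"
proof (cases "prime_factors B = {}")
  case True
  then have "B = 1" using prime_factorization_int[OF assms(1)] by simp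
  then show ?thesis using that[of 2 0] by simp
next
  case False
  then have "card (prime_factors B) = 1" using assms(2)
    by (metis card_0_eq finite_set_mset le_antisym less_one not_le)
  then obtain p where p: "prime_factors B = {p}" by (auto simp: card_1_singleton_iff)
  then have "prime p" by (metis in_prime_factors_imp_prime singletonI)
  moreover have "B = p ^ multiplicity p B" using prime_factorization_int[OF assms(1)] p by simp
  ultimately show ?thesis using that by blast
qed

lemma prime_power_dvd_twice_factor:
  fixes p u v m :: int
  assumes "prime p" "coprime (p ^ j) m" "p ^ j dvd u * v" "u + v = 2 * m"
  shows "p ^ j dvd 2 * u \<or> p ^ j dvd 2 * v"
proof -
  have cancel: "p ^ j dvd t" if "p ^ j dvd s * t" "\<not> p dvd s" for s t
  proof -
    have "coprime (p ^ j) s" using that(2) assms(1)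
      by (simp add: coprime_power_left_iff prime_imp_coprime)
    then show ?thesis using that(1) by (simp add: coprime_dvd_mult_right_iff)
  qed
  consider (unit) "j = 0" | (not_left) "\<not> p dvd u" | (not_right) "\<not> p dvd v"
    | (both) "j > 0" "p dvd u" "p dvd v" by blast
  then show ?thesis
  proof cases
    case not_left
    then show ?thesis using cancel[of u v] assms(3) by simp
  next
    case not_right
    then show ?thesis using cancel[of v u] assms(3) by (simp add: mult.commute)
  next
    case both
    then have "coprime p m" using assms(2) by (simp add: coprime_power_left_iff)
    then have "\<not> p dvd m" using assms(1) coprime_common_divisor[of p m p] by auto
    moreover have "p dvd 2 * m" using both by (simp flip: assms(4))
    ultimately have "p dvd 2" using assms(1) by (simp add: prime_dvd_mult_iff)
    then have p: "p = 2" using assms(1) by (simp add: primes_dvd_imp_eq)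
    obtain u' v' where halves: "u = 2 * u'" "v = 2 * v'" using both(2,3) p by (auto elim!: dvdE)
    then have "u' + v' = m" using assms(4) by simp
    then have "\<not> p dvd u' \<or> \<not> p dvd v'" using \<open>\<not> p dvd m\<close> by (metis dvd_add)
    moreover have "u' * (2 * v) = u * v" "v' * (2 * u) = u * v" by (simp_all add: halves)
    ultimately show ?thesis using cancel assms(3) by metis
  qed simp
qed

lemma cofactor_le_twice:
  fixes s t n d :: int
  assumes "s * t = n * d" "d dvd 2 * s" "s > 0" "n > 0"
  shows "t \<le> 2 * n"
proof -
  have "d \<le> 2 * s" using assms(2,3) by (intro zdvd_imp_le) auto
  then have "n * d \<le> n * (2 * s)" using assms(4) by simp
  then have "s * t \<le> s * (2 * n)" using assms(1) by (simp add: mult_ac)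
  then show ?thesis using assms(3) by simp
qed

lemma quartic_solution_factorization:
  fixes a B c N :: int
  assumes "N > 0" "a > 0" "B > 0" "coprime a B" "card (prime_factors B) \<le> 1"
    and "a ^ 4 = N * B ^ 4 + c ^ 2"
  shows "a ^ 2 \<le> 2 * N \<or>
    (\<exists>u. 0 < u \<and> u \<le> 2 * N \<and> u \<le> a ^ 2 \<and> u ^ 2 + N * B ^ 4 = 2 * u * a ^ 2)"
proof -
  define u v where "u = a ^ 2 - \<bar>c\<bar>" and "v = a ^ 2 + \<bar>c\<bar>"
  have prod: "u * v = N * B ^ 4"
    using assms(6)
    by (simp add: u_def v_def power2_eq_square power4_eq_xxxx algebra_simps flip: abs_mult)
  have sum: "u + v = 2 * a ^ 2" by (simp add: u_def v_def)
  have "v > 0" "a ^ 2 \<le> v" using assms(2) by (auto simp: v_def add_pos_nonneg)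
  moreover have "N * B ^ 4 > 0" using assms(1,3) by simp
  ultimately have "u > 0" using prod by (metis zero_less_mult_pos2)
  obtain p k where "prime p" "B = p ^ k"
    using prime_power_if_card_prime_factors_le_1[OF assms(3,5)] .
  then have "B ^ 4 dvd 2 * u \<or> B ^ 4 dvd 2 * v"
    using prime_power_dvd_twice_factor[of p "k * 4" "a ^ 2" u v] assms(4) prod sum
    by (simp add: power_mult coprime_commute)
  then show ?thesis
  proof
    assume "B ^ 4 dvd 2 * u"
    with prod have "v \<le> 2 * N" using \<open>u > 0\<close> assms(1) by (rule cofactor_le_twice)
    then show ?thesis using \<open>a ^ 2 \<le> v\<close> by simp
  next
    assume "B ^ 4 dvd 2 * v"
    moreover have "v * u = N * B ^ 4" using prod by (simp add: mult.commute)
    ultimately have "u \<le> 2 * N" using \<open>v > 0\<close> assms(1) by (intro cofactor_le_twice[of v u])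
    moreover have "u ^ 2 + N * B ^ 4 = u * (u + v)"
      by (simp add: power2_eq_square distrib_left prod)
    then have "u ^ 2 + N * B ^ 4 = 2 * u * a ^ 2" by (simp add: sum)
    moreover have "u \<le> a ^ 2" by (simp add: u_def)
    ultimately show ?thesis using \<open>u > 0\<close> by blast
  qed
qed

lemma quartic_rad_le:
  fixes a B u N :: int
  assumes "N \<ge> 2" "a > 0" "B > 0" "0 < u" "u \<le> N ^ 2"
  shows "rad (u ^ 2 * (N * B ^ 4) * (2 * u * a ^ 2)) \<le> N ^ 4 * B * a"
proof -
  have pos: "2 * u * N * B * a > 0" using assms by simp
  have "rad (u ^ 2 * (N * B ^ 4) * (2 * u * a ^ 2)) \<le> rad (2 * u * N * B * a)"
  proof (rule rad_mono)
    show "2 * u * N * B * a \<noteq> 0" using pos by (rule less_imp_neq[symmetric])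
    fix p :: int assume "prime p" "p dvd u ^ 2 * (N * B ^ 4) * (2 * u * a ^ 2)"
    then have "p dvd u \<or> p dvd N \<or> p dvd B \<or> p dvd 2 \<or> p dvd a"
      by (auto simp: prime_dvd_mult_iff dest: prime_dvd_power)
    then show "p dvd 2 * u * N * B * a" by auto
  qed
  also have "\<dots> \<le> 2 * u * N * B * a" using rad_dvd pos by (rule zdvd_imp_le)
  also have "2 * u * N * B * a \<le> N ^ 4 * B * a"
  proof -
    have "2 * u * N \<le> N * N ^ 2 * N" using assms by (intro mult_mono) simp_all
    also have "\<dots> = N ^ 4" by (simp add: eval_nat_numeral)
    finally show ?thesis using assms(2,3) by (intro mult_right_mono) simp_all
  qed
  finally show ?thesis .
qed

lemma quartic_abc_bound:
  fixes a B u N :: int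
  assumes "abc_bound (2 powr k) e" "k \<ge> 0" "e \<ge> 0" "N \<ge> 2" "a > 0" "B > 0"
    and "0 < u" "u \<le> 2 * N" "u ^ 2 + N * B ^ 4 = 2 * u * a ^ 2"
  shows "real_of_int (N * B ^ 4)
    \<le> real_of_int (N ^ 4) * (real_of_int N powr k * real_of_int (N ^ 4 * B * a) powr (1 + e))"
proof -
  let ?r = "rad (u ^ 2 * (N * B ^ 4) * (u ^ 2 + N * B ^ 4))"
  have "2 * N \<le> N ^ 2" using assms(4) by (simp add: power2_eq_square)
  with assms(8) have "u \<le> N ^ 2" by (rule order_trans)
  then have r: "?r \<le> N ^ 4 * B * a" using quartic_rad_le[of N a B u] assms(4-7,9) by simp
  have "u ^ 2 \<le> N ^ 4" using power_mono[OF \<open>u \<le> N ^ 2\<close>, of 2] assms(7) by simp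
  moreover have "gcd (u ^ 2) (N * B ^ 4) \<le> u ^ 2" using assms(7) by (intro gcd_le1_int) simp
  ultimately have gcd: "real_of_int (gcd (u ^ 2) (N * B ^ 4)) \<le> real_of_int (N ^ 4)"
    by (simp only: of_int_le_iff)
  have "real_of_int ?r powr (1 + e) \<le> real_of_int (N ^ 4 * B * a) powr (1 + e)"
    using r assms(3) less_imp_le[OF rad_pos]
    by (intro powr_mono2) (simp_all only: of_int_le_iff of_int_0_le_iff)
  moreover have "2 powr k \<le> real_of_int N powr k" using assms(2,4) by (intro powr_mono2) simp_all
  ultimately have factor: "2 powr k * real_of_int ?r powr (1 + e)
      \<le> real_of_int N powr k * real_of_int (N ^ 4 * B * a) powr (1 + e)"
    by (intro mult_mono) simp_all
  have nonzero: "u ^ 2 * (N * B ^ 4) * (u ^ 2 + N * B ^ 4) \<noteq> 0"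
    using assms(4-7) by (simp add: assms(9))
  have "real_of_int (N * B ^ 4) \<le> real_of_int \<bar>N * B ^ 4\<bar>" by simp
  also have "\<dots> \<le> real_of_int (gcd (u ^ 2) (N * B ^ 4)) * (2 powr k * real_of_int ?r powr (1 + e))"
    using assms(1) _ assms(3) nonzero by (rule abc_bound_gcd) simp
  also have "\<dots>
    \<le> real_of_int (N ^ 4) * (real_of_int N powr k * real_of_int (N ^ 4 * B * a) powr (1 + e))"
    by (rule mult_mono[OF gcd factor]) simp_all
  finally show ?thesis .
qed

lemma quartic_solution_ln_le:
  fixes a B c N :: int
  assumes "abc_bound (2 powr k) (1/6)" "k \<ge> 0" "N \<ge> 2"
    and "a > 0" "B > 0" "coprime a B" "card (prime_factors B) \<le> 1"
    and "a ^ 4 = N * B ^ 4 + c ^ 2"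
  shows "2 * ln (real_of_int a) - 2 * ln (real_of_int B) \<le> (34 + 4 * k) * ln (real_of_int N)"
proof -
  define LN LB LA where "LN = ln (real_of_int N)" and "LB = ln (real_of_int B)"
    and "LA = ln (real_of_int a)"
  have ln_of_int_mono: "ln (real_of_int s) \<le> ln (real_of_int t)" if "0 < s" "s \<le> t" for s t
    using that by simp
  have "LB \<ge> 0" "LN \<ge> 0" "k * LN \<ge> 0" using assms(2,3,5) by (simp_all add: LB_def LN_def)
  consider (small) "a ^ 2 \<le> 2 * N"
    | (factor) u where "0 < u" "u \<le> 2 * N" "u \<le> a ^ 2" "u ^ 2 + N * B ^ 4 = 2 * u * a ^ 2"
    using quartic_solution_factorization[of N a B c] assms(3-8) by auto
  then have "2 * LA - 2 * LB \<le> 34 * LN + 4 * (k * LN)"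
  proof cases
    case small
    also have "2 * N \<le> N ^ 2" using assms(3) by (simp add: power2_eq_square)
    finally have "ln (real_of_int (a ^ 2)) \<le> ln (real_of_int (N ^ 2))"
      using assms(4) by (intro ln_of_int_mono) auto
    then have "LA \<le> LN" using assms(3,4) by (simp add: LA_def LN_def ln_realpow)
    then show ?thesis using \<open>LB \<ge> 0\<close> \<open>LN \<ge> 0\<close> \<open>k * LN \<ge> 0\<close> by linarith
  next
    case (factor u)
    have "u * a ^ 2 \<le> u * (2 * a ^ 2 - u)" using factor(1,3) by (intro mult_left_mono) auto
    also have "\<dots> = N * B ^ 4" using factor(4) by (simp add: power2_eq_square algebra_simps)
    finally have "a ^ 2 \<le> N * B ^ 4" using mult_right_mono[of 1 u "a ^ 2"] factor(1) by simp
    then have "ln (real_of_int (a ^ 2)) \<le> ln (real_of_int (N * B ^ 4))"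
      using assms(4) by (intro ln_of_int_mono) auto
    then have LA: "2 * LA \<le> LN + 4 * LB"
      using assms(3-5) by (simp add: LA_def LN_def LB_def ln_realpow ln_mult)
    have "ln (real_of_int (N * B ^ 4))
      \<le> ln (real_of_int (N ^ 4)
          * (real_of_int N powr k * real_of_int (N ^ 4 * B * a) powr (1 + 1/6)))"
      using quartic_abc_bound[OF assms(1,2) _ assms(3-5) factor(1,2,4)] assms(3-5)
      by (subst ln_le_cancel_iff) (auto intro!: mult_pos_pos)
    then have "LN + 4 * LB \<le> 4 * LN + (k * LN + 7/6 * (4 * LN + LB + LA))"
      using assms(3-5) by (simp add: LA_def LN_def LB_def ln_realpow ln_mult ln_powr)
    then show ?thesis using LA by argo
  qed
  then show ?thesis by (simp add: LA_def LN_def LB_def algebra_simps)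
qed

section \<open>Heights of points of small length\<close>

lemma on_curve_square_xcoordE:
  assumes "on_curve N (Pt (r ^ 2) y)" "r \<noteq> 0"
  obtains a B c :: int where "a > 0" "B > 0" "coprime a B" "r ^ 2 = (of_int a / of_int B) ^ 2"
    "snd (quotient_of (r ^ 2)) = B ^ 2" "a ^ 4 = N * B ^ 4 + c ^ 2"
proof -
  obtain a B where "\<bar>r\<bar> = Fract a B" "B > 0" "coprime a B" by (rule Rat_cases)
  then have r: "\<bar>r\<bar> = of_int a / of_int B" by (simp add: Fract_of_int_quotient)
  have "of_int a / of_int B > (0 :: rat)" using assms(2) r[symmetric] by simp
  then have "a > 0" using \<open>B > 0\<close> by (simp add: zero_less_divide_iff)
  have r_sq: "r ^ 2 = (of_int a / of_int B) ^ 2" unfolding r[symmetric] by simp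
  then have "r ^ 2 = Fract (a ^ 2) (B ^ 2)" by (simp add: Fract_of_int_quotient power_divide)
  then have denominator: "snd (quotient_of (r ^ 2)) = B ^ 2"
    using \<open>B > 0\<close> \<open>coprime a B\<close> by (simp add: quotient_of_Fract)
  have "y ^ 2 = r ^ 2 * ((r ^ 2) ^ 2 - of_int N)"
    using assms(1) by (simp add: power3_eq_cube power2_eq_square algebra_simps)
  then have "(y / r) ^ 2 = (r ^ 2) ^ 2 - of_int N"
    using assms(2) by (simp add: power_divide)
  then have "(y / r * of_int B ^ 2) ^ 2 = ((r ^ 2) ^ 2 - of_int N) * of_int B ^ 4"
    by (simp only: power_mult_distrib) simp
  also have "\<dots> = of_int (a ^ 4 - N * B ^ 4)"
    using \<open>B > 0\<close> unfolding r_sq by (simp add: power_divide field_simps)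
  finally obtain c where "a ^ 4 - N * B ^ 4 = c ^ 2" by (rule rat_power_eq_of_intE) simp
  then have "a ^ 4 = N * B ^ 4 + c ^ 2" by simp
  with \<open>a > 0\<close> \<open>B > 0\<close> \<open>coprime a B\<close> r_sq denominator show thesis by (rule that)
qed

lemma xcoord_square_le_if_descent_image_neg:
  assumes "on_curve N Q" "N > 0" "descent_image N Q < 0"
  shows "(xcoord Q) ^ 2 \<le> of_int N"
proof (cases Q)
  case (Pt x y)
  show ?thesis
  proof (cases "x = 0")
    case False
    then have "x < 0" using assms(3) Pt by simp
    have "0 \<le> y ^ 2" by simp
    also have "y ^ 2 = x * (x ^ 2 - of_int N)"
      using assms(1) Pt by (simp add: power2_eq_square power3_eq_cube algebra_simps)
    finally show ?thesis using Pt \<open>x < 0\<close> by (simp add: zero_le_mult_iff)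
  qed (use Pt assms(2) in simp)
qed (use assms(2) in simp)

lemma hO_le_if_descent_image_neg:
  assumes "on_curve N Q" "N > 0" "descent_image N Q < 0"
  shows "2 * hO Q \<le> ln (real_of_int N)"
proof -
  define x where "x = real_of_rat (xcoord Q)"
  have "real_of_rat ((xcoord Q) ^ 2) \<le> real_of_rat (of_int N)"
    using xcoord_square_le_if_descent_image_neg[OF assms] by (simp only: of_rat_less_eq)
  then have "x ^ 2 \<le> real_of_int N" by (simp add: x_def of_rat_power)
  then have "ln (x ^ 2) \<le> ln (real_of_int N)" if "x \<noteq> 0" using that by (intro ln_mono) simp_all
  moreover have "ln (x ^ 2) = 2 * ln \<bar>x\<bar>" if "x \<noteq> 0" using that ln_realpow[of "\<bar>x\<bar>" 2] by simp
  ultimately have "2 * ln \<bar>x\<bar> \<le> ln (real_of_int N)" if "x \<noteq> 0" using that by simp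
  then show ?thesis using assms(2) unfolding hO_def x_def[symmetric]
    by (cases "x = 0") (auto simp: max_def)
qed

lemma hO_le_if_descent_image_square:
  assumes "abc_bound (2 powr k) (1/6)" "k \<ge> 0" "N \<ge> 2"
    and "on_curve N Q" "same_square_class (descent_image N Q) 1" "Q \<noteq> Inf" "ec_len Q \<le> 1"
  shows "hO Q \<le> (34 + 4 * k) * ln (real_of_int N)"
proof -
  obtain x y where Q: "Q = Pt x y" using assms(6) by (cases Q) auto
  obtain r where r: "r \<noteq> 0" "descent_image N Q = r ^ 2"
    using assms(5) by (auto simp: same_square_class_def)
  then have "descent_image N Q > 0" by simp
  then have "x \<noteq> 0" using assms(3) by (auto simp: Q)
  then have x: "x = r ^ 2" using r(2) by (simp add: Q)
  obtain a B c :: int where quartic: "a > 0" "B > 0" "coprime a B" "a ^ 4 = N * B ^ 4 + c ^ 2"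
    and r_sq: "r ^ 2 = (of_int a / of_int B) ^ 2" "snd (quotient_of (r ^ 2)) = B ^ 2"
    using on_curve_square_xcoordE[OF _ r(1)] assms(4) unfolding Q x by metis
  have "prime_factors (B ^ 2) = prime_factors B"
    using quartic(2) by (simp add: power2_eq_square prime_factorization_mult)
  then have "card (prime_factors B) \<le> 1" using assms(7) by (simp add: ec_len_def Q x r_sq(2))
  with assms(1-3) quartic(1-3)
  have "2 * ln (real_of_int a) - 2 * ln (real_of_int B) \<le> (34 + 4 * k) * ln (real_of_int N)"
    using quartic(4) by (rule quartic_solution_ln_le)
  moreover have "real_of_rat (xcoord Q) = (real_of_int a / real_of_int B) ^ 2"
    by (simp add: Q x r_sq(1) of_rat_power of_rat_divide)
  then have "ln \<bar>real_of_rat (xcoord Q)\<bar> = 2 * ln (real_of_int a) - 2 * ln (real_of_int B)"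
    using quartic(1,2) by (simp add: ln_realpow ln_div)
  moreover have "0 \<le> (34 + 4 * k) * ln (real_of_int N)" using assms(2,3) by simp
  ultimately show ?thesis by (simp add: hO_def)
qed

lemma hO_combination_le:
  assumes "abc_bound (2 powr k) (1/6)" "k \<ge> 0" "N \<ge> 2"
    and "on_curve N P" "xcoord P < 0" "on_curve N P'" "same_square_class (descent_image N P') 1"
    and "Q = ec_add N (ec_mul N m P) (ec_mul N n P')" "Q \<noteq> Inf" "ec_len Q \<le> 1"
  shows "hO Q \<le> (34 + 4 * k) * ln (real_of_int N)"
proof -
  have "N \<noteq> 0" using assms(3) by simp
  have Q: "on_curve N Q" by (simp add: assms(4,6,8) on_curve_ec_add on_curve_ec_mul)
  have "descent_image N P < 0" using assms(5) by (cases P) simp_all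
  have power: "same_square_class (descent_image N Q) (descent_image N P ^ nat \<bar>m\<bar>)"
    unfolding assms(8) using \<open>N \<noteq> 0\<close> assms(4,6,7) by (rule descent_image_combination)
  show ?thesis
  proof (cases "even m")
    case True
    then have "same_square_class (descent_image N P ^ nat \<bar>m\<bar>) 1"
      using \<open>descent_image N P < 0\<close>
      by (intro same_square_class_even_power) (simp_all add: even_nat_iff)
    with power have "same_square_class (descent_image N Q) 1" by (rule same_square_class_trans)
    then show ?thesis using Q assms(1-3,9,10) by (intro hO_le_if_descent_image_square)
  next
    case False
    then have "descent_image N P ^ nat \<bar>m\<bar> < 0"
      using \<open>descent_image N P < 0\<close> by (simp add: power_less_zero_eq even_nat_iff)
    then have "descent_image N Q < 0" using same_square_class_neg_iff[OF power] by simp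
    then have "2 * hO Q \<le> ln (real_of_int N)"
      using Q assms(3) by (intro hO_le_if_descent_image_neg) simp_all
    moreover have "1 * ln (real_of_int N) \<le> (34 + 4 * k) * ln (real_of_int N)"
      using assms(2,3) by (intro mult_right_mono) simp_all
    moreover have "hO Q \<ge> 0" by (simp add: hO_def)
    ultimately show ?thesis by linarith
  qed
qed

theorem theorem1p2:
  assumes "abc_conjecture"
  shows "\<exists>C::real. C > 0 \<and>
    (\<forall>(N::int) Q1. N > 0 \<and> on_curve N Q1 \<and> Q1 \<noteq> Inf \<and>
        (\<forall>n::int. n \<noteq> 0 \<longrightarrow> ec_mul N n Q1 \<noteq> Inf) \<and> xcoord Q1 < 0 \<longrightarrow>
       (\<forall>n::int. n \<noteq> 0 \<and> ec_len (ec_mul N n Q1) \<le> 1 \<longrightarrow>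
           hO (ec_mul N n Q1) \<le> C * ln (real_of_int N)) \<and>
       (\<forall>Q2. on_curve N Q2 \<and>
            (\<forall>a b :: int. ec_add N (ec_mul N a Q1) (ec_mul N b Q2) = Inf \<longrightarrow> a = 0 \<and> b = 0) \<and>
            ((\<exists>R. on_curve N R \<and> Q2 = ec_add N R R) \<or> (\<exists>r::rat. Q2 \<noteq> Inf \<and> xcoord Q2 = r ^ 2)) \<longrightarrow>
          (\<forall>Q. (\<exists>n1 n2 :: int. Q = ec_add N (ec_mul N n1 Q1) (ec_mul N n2 Q2)) \<and>
               Q \<noteq> Inf \<and> ec_len Q \<le> 1 \<longrightarrow> hO Q \<le> C * ln (real_of_int N))))"
proof -
  obtain k where k: "k \<ge> 0" "abc_bound (2 powr k) (1/6)"
    using assms by (rule abc_conjecture_abc_boundE[of "1/6"]) simp_all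
  show ?thesis
  proof (intro exI[of _ "34 + 4 * k"] conjI allI impI; (elim conjE)?)
    show "34 + 4 * k > 0" using k(1) by simp
  next
    fix N Q1 and n :: int
    assume Q1: "N > 0" "on_curve N Q1" "xcoord Q1 < 0" "\<forall>n::int. n \<noteq> 0 \<longrightarrow> ec_mul N n Q1 \<noteq> Inf"
      and n: "n \<noteq> 0" "ec_len (ec_mul N n Q1) \<le> 1"
    then have N: "N \<ge> 2" by (intro ge_2_if_not_2_torsion) auto
    show "hO (ec_mul N n Q1) \<le> (34 + 4 * k) * ln (real_of_int N)"
      using hO_combination_le[OF k(2,1) N Q1(2,3), of Inf _ n 0] Q1(4) n by simp
  next
    fix N Q1 Q2 Q
    assume Q1: "N > 0" "on_curve N Q1" "xcoord Q1 < 0" "\<forall>n::int. n \<noteq> 0 \<longrightarrow> ec_mul N n Q1 \<noteq> Inf"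
      and Q2: "on_curve N Q2"
        "\<forall>a b :: int. ec_add N (ec_mul N a Q1) (ec_mul N b Q2) = Inf \<longrightarrow> a = 0 \<and> b = 0"
        "(\<exists>R. on_curve N R \<and> Q2 = ec_add N R R) \<or> (\<exists>r::rat. Q2 \<noteq> Inf \<and> xcoord Q2 = r ^ 2)"
      and Q: "\<exists>n1 n2 :: int. Q = ec_add N (ec_mul N n1 Q1) (ec_mul N n2 Q2)"
        "Q \<noteq> Inf" "ec_len Q \<le> 1"
    then have N: "N \<ge> 2" by (intro ge_2_if_not_2_torsion) auto
    have "ec_mul N 2 Q2 \<noteq> Inf" using Q2(2)[rule_format, of 0 2] by auto
    then have "same_square_class (descent_image N Q2) 1"
      using Q1(1) Q2(1,3) descent_image_double descent_image_square_xcoord by (metis less_irrefl)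
    then show "hO Q \<le> (34 + 4 * k) * ln (real_of_int N)"
      using hO_combination_le[OF k(2,1) N Q1(2,3) Q2(1)] Q by blast
  qed
qed

end
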